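(* Let $d=(d_n)_{n\ge0}$ be a monotonic increasing, unbounded sequence of positive real numbers and let $a=(a_n)_{n\ge0}\in\mathscr M(h_d)$ with $a_0\neq0$ and $a_1\neq0$. Then the point spectrum of $T_a$ on $h_d$ is empty: $\sigma_p(T_a,h_d)=\emptyset$.
   Context: All sequences are complex and indexed by $\mathbb N_0=\{0,1,2,\dots\}$. The weighted Hahn space is $h_d=\{x\in\mathbb C^{\mathbb N_0}:\sum_{n=0}^\infty d_n|x_n-x_{n+1}|<\infty,\ \lim_n x_n=0\}$ with norm $\|x\|_{h_d}=\sum_{n=0}^\infty d_n|x_n-x_{n+1}|$; it is a Banach space. The convolution is $(a*x)_n=\sum_{k=0}^n a_{n-k}x_k$, and $T_a(x)=a*x$. The multiplier of a sequence space $X$ is $\mathscr M(X)=\{a\in\mathbb C^{\mathbb N_0}: a*x\in X\text{ for all }x\in X\}$. The point spectrum $\sigma_p(T,X)$ is the set of eigenvalues of $T$, i.e. of $\lambda\in\mathbb C$ with $T-\lambda I$ not injective on $X$. *)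

theory Defs
  imports Complex_Main
begin

definition weighted_hahn :: "(nat \<Rightarrow> real) \<Rightarrow> (nat \<Rightarrow> complex) set" where
  "weighted_hahn d =
    {x. summable (\<lambda>n. d n * cmod (x n - x (Suc n))) \<and> x \<longlonglongrightarrow> 0}"

definition conv :: "(nat \<Rightarrow> complex) \<Rightarrow> (nat \<Rightarrow> complex) \<Rightarrow> nat \<Rightarrow> complex" where
  "conv a x n = (\<Sum>k\<le>n. a (n - k) * x k)"

definition conv_op :: "(nat \<Rightarrow> complex) \<Rightarrow> (nat \<Rightarrow> complex) \<Rightarrow> (nat \<Rightarrow> complex)" where
  "conv_op a = (\<lambda>x. conv a x)"

definition multipliers :: "(nat \<Rightarrow> complex) set \<Rightarrow> (nat \<Rightarrow> complex) set" where
  "multipliers X = {a. \<forall>x\<in>X. conv a x \<in> X}"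

(* Operators on a sequence space X are represented by functions on all sequences; only
   their restriction to X matters here. *)
definition point_spectrum ::
    "((nat \<Rightarrow> complex) \<Rightarrow> (nat \<Rightarrow> complex)) \<Rightarrow> (nat \<Rightarrow> complex) set \<Rightarrow> complex set" where
  "point_spectrum T X = {l. \<not> inj_on (\<lambda>x n. T x n - l * x n) X}"

end

theory Submission
  imports Defs "HOL-Computational_Algebra.Formal_Power_Series"
begin

text \<open>Under the identification of a sequence with its generating power series, the operator
  \<open>T_a - \<lambda>I\<close> is multiplication by \<open>A - \<lambda>\<close>. This series is nonzero because its
  coefficient of degree 1 is \<open>a 1\<close>, and formal power series over the complex numbers form an
  integral domain, so the operator is injective on all sequences.\<close>

lemma Abs_fps_conv: "Abs_fps (conv a x) = Abs_fps a * Abs_fps x"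
proof (rule fps_ext)
  fix n
  \<comment> \<open>The factors are swapped because \<open>fps_mult_nth\<close> puts the summation
    index on the first factor, whereas \<open>conv\<close> puts it on \<open>x\<close> and
    \<open>n - k\<close> on \<open>a\<close>.\<close>
  have "fps_nth (Abs_fps x * Abs_fps a) n = conv a x n"
    unfolding fps_mult_nth conv_def atLeast0AtMost by (simp add: mult.commute)
  then show "fps_nth (Abs_fps (conv a x)) n = fps_nth (Abs_fps a * Abs_fps x) n"
    by (simp only: mult.commute[of "Abs_fps x"] fps_nth_Abs_fps)
qed

lemma inj_conv_minus_scale:
  assumes "a 1 \<noteq> 0"
  shows "inj (\<lambda>x n. conv a x n - l * x n)"
proof (rule injI)
  fix x y :: "nat \<Rightarrow> complex"
  let ?B = "Abs_fps a - fps_const l"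
  have *: "Abs_fps (\<lambda>n. conv a z n - l * z n) = ?B * Abs_fps z" for z
    unfolding left_diff_distrib Abs_fps_conv[symmetric] by (rule fps_ext) simp
  assume "(\<lambda>n. conv a x n - l * x n) = (\<lambda>n. conv a y n - l * y n)"
  then have "?B * Abs_fps x = ?B * Abs_fps y"
    by (simp flip: *)
  \<comment> \<open>Degree 1 works for every \<open>l\<close>: subtracting
    \<open>fps_const l\<close> changes only the constant term, which vanishes when
    \<open>l = a 0\<close>.\<close>
  moreover have "fps_nth ?B 1 \<noteq> 0"
    using assms by simp
  then have "?B \<noteq> 0"
    by (metis fps_zero_nth)
  ultimately have "Abs_fps x = Abs_fps y"
    by simp
  then show "x = y"
    by (simp add: Abs_fps_inject)
qed

theorem proposition6p5:
  fixes d :: "nat \<Rightarrow> real" and a :: "nat \<Rightarrow> complex"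
  assumes "\<And>n. d n > 0"
    and "mono d"
    and "\<not> bdd_above (range d)"
    and "a \<in> multipliers (weighted_hahn d)"
    and "a 0 \<noteq> 0" and "a 1 \<noteq> 0"
  shows "point_spectrum (conv_op a) (weighted_hahn d) = {}"
  \<comment> \<open>Injectivity passes to the subspace for each \<open>l\<close>, so no
    \<open>l\<close> is an eigenvalue.\<close>
  using inj_on_subset[OF inj_conv_minus_scale[of a, OF \<open>a 1 \<noteq> 0\<close>] subset_UNIV]
  unfolding point_spectrum_def conv_op_def by blast

end
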